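(* Let $\alpha\in(0,1/2)$, let $h\in\mathcal{F}(\alpha)$, and let $f=h+\overline{g}$ be a sense-preserving harmonic mapping in $\mathbb{D}$ with dilatation $\omega=g'/h'$. If $$|\omega(z)|\leq1-\alpha|z|(1+|z|)\quad\text{for all } z\in\mathbb{D},$$ then $f$ is univalent in $\mathbb{D}$.
   Context: $\mathbb{D}=\{z\in\mathbb{C}:|z|<1\}$. $\mathcal{A}$ is the family of analytic functions $h$ in $\mathbb{D}$ with $h(0)=0$ and $h'(0)=1$. For $\alpha\in(0,3]$, $\mathcal{F}(\alpha)$ is the family of locally univalent functions $h\in\mathcal{A}$ (i.e. $h'(z)\neq0$ in $\mathbb{D}$) such that $\operatorname{Re}\left(1+\frac{zh''(z)}{h'(z)}\right)>1-\frac{\alpha}{2}$ for all $z\in\mathbb{D}$. A harmonic mapping in $\mathbb{D}$ is written canonically as $f=h+\overline{g}$ with $h,g$ analytic in $\mathbb{D}$ and $g(0)=0$; it is sense-preserving if its Jacobian $J_f=|h'|^2-|g'|^2$ is positive on $\mathbb{D}$, equivalently $h'\ne0$ and its dilatation $\omega=g'/h'$ satisfies $|\omega|<1$ on $\mathbb{D}$. *)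

theory Defs
  imports "HOL-Complex_Analysis.Complex_Analysis"
begin

abbreviation unit_disk :: "complex set"
  where "unit_disk \<equiv> ball 0 1"

definition class_A :: "(complex \<Rightarrow> complex) set"
  where "class_A = {h. h holomorphic_on unit_disk \<and> h 0 = 0 \<and> deriv h 0 = 1}"

definition locally_univalent_on :: "(complex \<Rightarrow> complex) \<Rightarrow> complex set \<Rightarrow> bool"
  where "locally_univalent_on h S \<longleftrightarrow> (\<forall>z\<in>S. deriv h z \<noteq> 0)"

(* The family is of interest for 0 < \<alpha> \<le> 3; the range of \<alpha> is imposed
   where the family is used. *)
definition class_F :: "real \<Rightarrow> (complex \<Rightarrow> complex) set"
  where "class_F \<alpha> = {h \<in> class_A. locally_univalent_on h unit_disk \<and>
    (\<forall>z\<in>unit_disk. Re (1 + z * deriv (deriv h) z / deriv h z) > 1 - \<alpha> / 2)}"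

(* On a simply connected domain, every complex-valued harmonic f is h + cnj g with
   h, g analytic; the normalization g 0 = 0 makes the pair (h, g) unique. *)
definition harmonic_mapping_rep ::
    "(complex \<Rightarrow> complex) \<Rightarrow> (complex \<Rightarrow> complex) \<Rightarrow> (complex \<Rightarrow> complex) \<Rightarrow> bool"
  where "harmonic_mapping_rep f h g \<longleftrightarrow>
    h holomorphic_on unit_disk \<and> g holomorphic_on unit_disk \<and> g 0 = 0 \<and>
    (\<forall>z\<in>unit_disk. f z = h z + cnj (g z))"

(* The real Jacobian determinant of f = h + cnj g, whose differential at z is
   v \<mapsto> h' z * v + cnj (g' z * v). *)
definition harmonic_jacobian :: "(complex \<Rightarrow> complex) \<Rightarrow> (complex \<Rightarrow> complex) \<Rightarrow> complex \<Rightarrow> real"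
  where "harmonic_jacobian h g z = (cmod (deriv h z))\<^sup>2 - (cmod (deriv g z))\<^sup>2"

definition sense_preserving_harmonic ::
    "(complex \<Rightarrow> complex) \<Rightarrow> (complex \<Rightarrow> complex) \<Rightarrow> (complex \<Rightarrow> complex) \<Rightarrow> bool"
  where "sense_preserving_harmonic f h g \<longleftrightarrow>
    harmonic_mapping_rep f h g \<and> (\<forall>z\<in>unit_disk. harmonic_jacobian h g z > 0)"

definition dilatation :: "(complex \<Rightarrow> complex) \<Rightarrow> (complex \<Rightarrow> complex) \<Rightarrow> complex \<Rightarrow> complex"
  where "dilatation h g z = deriv g z / deriv h z"

end

theory Submission
  imports Defs
begin

text \<open>
  The bound on the dilatation \<open>\<omega> = g' / h'\<close> turns out to force
  \<open>\<bar>g'\<bar> < Re h'\<close> on the disk. This is a harmonic version of the Noshiro--Warschawski condition: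
  along the segment from \<open>a\<close> to \<open>b\<close>, the component of \<open>h + cnj g\<close> in the direction
  \<open>b - a\<close> is strictly increasing, so the two end points have different images
  (\<open>inj_on_harmonic_if_Re_deriv_dominates\<close>).

  What has to be controlled is therefore the argument of \<open>h'\<close>. Put
  \<open>q = h' powr (- 1 / \<alpha>)\<close>, with the branch that is 1 at the origin. The condition that
  defines the family says exactly that \<open>Re (z q' / q) < 1 / 2\<close>, and Jack's lemma
  converts this into \<open>\<bar>q - 1\<bar> < 1\<close>
  (\<open>norm_diff_one_less_if_Re_log_deriv_less\<close>); the Schwarz lemma sharpens it to
  \<open>\<bar>q z - 1\<bar> \<le> \<bar>z\<bar>\<close>. In other words, \<open>h'\<close> is subordinate to
  \<open>(1 - z) powr (- \<alpha>)\<close>. The disk of radius \<open>r\<close> around 1 lies in the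
  sector of half-angle \<open>arcsin r\<close>, and \<open>cos (arcsin r) \<ge> 1 - r\<^sup>2\<close>
  (\<open>cos_Im_Ln_ge\<close>). Passing from \<open>q\<close> back to \<open>h'\<close> multiplies the angle by
  \<open>- \<alpha>\<close>, and the concavity of the cosine (\<open>cos_scale_ge\<close>) gives
  \<open>Re h' \<ge> \<bar>h'\<bar> (1 - \<alpha> r\<^sup>2)\<close> at \<open>\<bar>z\<bar> = r\<close>. Since
  \<open>\<bar>g'\<bar> \<le> \<bar>h'\<bar> (1 - \<alpha> r (1 + r))\<close>, this dominates \<open>\<bar>g'\<bar>\<close> as soon as
  \<open>r > 0\<close>; at the origin \<open>h' = 1\<close>, and there the strict inequality is the
  positivity of the Jacobian.
\<close>

text \<open>
  A form of Jack's lemma. In its usual form it says that \<open>z0 w'(z0) / w(z0)\<close> is a real number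
  \<open>k \<ge> 1\<close>. For a number \<open>A\<close> this is equivalent to \<open>Re u \<le> Re (u A)\<close> for all \<open>u\<close> in the right
  half-plane, and that is the shape in which one inequality, without a separate look at the
  radial and the tangential derivative, both proves and applies it: along the curve
  \<open>z0 exp (- t u)\<close>, which runs into the disk, the Schwarz lemma makes \<open>\<bar>w\<bar>\<close> decay at least
  as fast as \<open>exp (- t Re u)\<close>, and one compares derivatives at \<open>t = 0\<close>.
\<close>
lemma jack_lemma:
  fixes w :: "complex \<Rightarrow> complex"
  assumes holo: "w holomorphic_on ball 0 R" and w0: "w 0 = 0"
    and z0: "z0 \<in> ball 0 R" "z0 \<noteq> 0"
    and max: "\<And>z. cmod z < cmod z0 \<Longrightarrow> cmod (w z) < cmod (w z0)"
    and u: "Re u > 0"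
  shows "Re u \<le> Re (u * (z0 * deriv w z0 / w z0))"
proof (rule ccontr)
  assume neg: "\<not> ?thesis"
  have wz0: "w z0 \<noteq> 0"
    using max[of 0] z0(2) by auto
  \<comment> \<open>Rescaled so that \<open>z0\<close> becomes 1 and the Schwarz lemma on the unit disk applies.\<close>
  define W where "W = (\<lambda>s. w (z0 * s) / w z0)"
  have sub: "z0 * s \<in> ball 0 R" if "cmod s < 1" for s
  proof -
    have "cmod (z0 * s) \<le> cmod z0 * 1"
      unfolding norm_mult using that by (intro mult_left_mono) auto
    then show ?thesis using z0 by auto
  qed
  have "W holomorphic_on ball 0 1"
    unfolding W_def using wz0 sub
    by (intro holomorphic_intros holomorphic_on_compose_gen[OF _ holo, unfolded o_def]) auto
  moreover have "W 0 = 0" by (simp add: W_def w0)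
  moreover have "cmod (W s) < 1" if "cmod s < 1" for s
  proof -
    have "cmod (z0 * s) < cmod z0"
      using that z0(2) by (simp add: norm_mult)
    then show ?thesis
      using max[of "z0 * s"] wz0 by (simp add: W_def norm_divide)
  qed
  ultimately have schwarz: "cmod (W s) \<le> cmod s" if "cmod s < 1" for s
    using Schwarz_Lemma(1) that by blast
  \<comment> \<open>\<open>\<psi>\<close> vanishes at 0 and is nonpositive afterwards, so its derivative at 0 cannot be positive.\<close>
  define \<psi> where "\<psi> = (\<lambda>t::real. Re (W (exp (- (of_real t * u)))) - exp (- (t * Re u)))"
  have Dw: "(w has_field_derivative deriv w z0) (at z0)"
    using holo z0 by (intro holomorphic_derivI) auto
  have DW: "(W has_field_derivative deriv w z0 * z0 / w z0) (at 1)"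
    unfolding W_def using Dw wz0
    by (auto intro!: derivative_eq_intros DERIV_chain2[where g = "\<lambda>s. z0 * s" and f = w])
  have "((\<lambda>t. W (exp (- (t * u)))) has_field_derivative
      deriv w z0 * z0 / w z0 * (- u)) (at (of_real 0))"
    by (rule DERIV_chain2[where f = W]) (use DW in \<open>auto intro!: derivative_eq_intros\<close>)
  then have "((\<lambda>t::real. Re (W (exp (- (of_real t * u))))) has_field_derivative
      Re (deriv w z0 * z0 / w z0 * (- u))) (at 0)"
    by (intro has_field_derivative_Re has_vector_derivative_real_field)
  moreover have "((\<lambda>t::real. exp (- (t * Re u))) has_field_derivative - Re u) (at 0)"
    by (auto intro!: derivative_eq_intros)
  ultimately have "(\<psi> has_field_derivative
      Re (deriv w z0 * z0 / w z0 * (- u)) - (- Re u)) (at 0)"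
    unfolding \<psi>_def by (rule DERIV_diff)
  moreover have "Re (deriv w z0 * z0 / w z0 * (- u)) - (- Re u) > 0"
    using neg by (simp add: mult_ac)
  ultimately obtain d where d: "d > 0" "\<And>t. 0 < t \<Longrightarrow> t < d \<Longrightarrow> \<psi> 0 < \<psi> (0 + t)"
    using DERIV_pos_inc_right by blast
  define t where "t = d / 2"
  have "\<psi> 0 < \<psi> t" and "t > 0" using d(1) d(2)[of t] by (auto simp: t_def)
  moreover have "\<psi> 0 = 0" using wz0 by (simp add: \<psi>_def W_def)
  moreover have "\<psi> t \<le> 0"
  proof -
    have n: "cmod (exp (- (of_real t * u))) = exp (- (t * Re u))" by simp
    have "Re (W (exp (- (of_real t * u)))) \<le> cmod (W (exp (- (of_real t * u))))"
      by (rule complex_Re_le_cmod)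
    also have "\<dots> \<le> exp (- (t * Re u))"
      using schwarz[of "exp (- (of_real t * u))"] \<open>t > 0\<close> u unfolding n by simp
    finally show ?thesis by (simp add: \<psi>_def)
  qed
  ultimately show False by simp
qed

text \<open>
  Consider \<open>w = 1 - q\<close> at a point \<open>z0\<close> of least modulus with \<open>\<bar>w z0\<bar> \<ge> 1\<close>. There
  \<open>z q' / q = u (z w' / w)\<close> with \<open>u = - w / (1 - w)\<close>, and \<open>w \<mapsto> - w / (1 - w)\<close> maps the
  outside of the unit disk to the half-plane \<open>Re u \<ge> 1 / 2\<close>. Jack's lemma in direction \<open>u\<close>
  then contradicts the assumption on \<open>q\<close>.
\<close>
lemma norm_diff_one_less_if_Re_log_deriv_less:
  assumes holo: "q holomorphic_on ball 0 1" and q0: "q 0 = 1"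
    and nz: "\<And>z. z \<in> ball 0 1 \<Longrightarrow> q z \<noteq> 0"
    and re: "\<And>z. z \<in> ball 0 1 \<Longrightarrow> Re (z * deriv q z / q z) < 1 / 2"
    and z: "z \<in> ball 0 1"
  shows "cmod (q z - 1) < 1"
proof (rule ccontr)
  assume ge: "\<not> ?thesis"
  define w where "w = (\<lambda>z. 1 - q z)"
  have holw: "w holomorphic_on ball 0 1"
    unfolding w_def using holo by (intro holomorphic_intros)
  define K where "K = cball 0 (cmod z) \<inter> (\<lambda>x. cmod (w x)) -` {1..}"
  have "continuous_on (cball 0 (cmod z)) (\<lambda>x. cmod (w x))"
    using z by (intro continuous_on_norm holomorphic_on_imp_continuous_on
        holomorphic_on_subset[OF holw]) auto
  then have "closed K"
    unfolding K_def by (intro continuous_closed_preimage) auto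
  then have "compact K"
    by (metis K_def compact_Int_closed compact_cball compact_eq_bounded_closed
        bounded_Int bounded_cball)
  moreover have "z \<in> K"
    using ge by (auto simp: K_def w_def norm_minus_commute)
  ultimately obtain z0 where z0: "z0 \<in> K" "\<And>x. x \<in> K \<Longrightarrow> cmod z0 \<le> cmod x"
    using continuous_attains_inf[of K cmod] continuous_on_norm_id by blast
  have z0b: "z0 \<in> ball 0 1" and ge1: "cmod (w z0) \<ge> 1" and z0z: "cmod z0 \<le> cmod z"
    using z0(1) z by (auto simp: K_def)
  have less: "cmod (w x) < cmod (w z0)" if "cmod x < cmod z0" for x
  proof -
    have "x \<notin> K" using z0(2)[of x] that by linarith
    then have "cmod (w x) < 1" using that z0z by (auto simp: K_def)
    then show ?thesis using ge1 by linarith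
  qed
  have w00: "w 0 = 0" by (simp add: w_def q0)
  then have z0nz: "z0 \<noteq> 0" using ge1 by auto
  have qnz: "q z0 \<noteq> 0" using nz z0b by auto
  define u where "u = - w z0 / q z0"
  have sq: "1 \<le> (Re (w z0))\<^sup>2 + (Im (w z0))\<^sup>2"
    using ge1 by (metis cmod_power2 one_le_power)
  have "(Re (q z0))\<^sup>2 + (Im (q z0))\<^sup>2 > 0"
    using qnz by (metis complex_neq_0)
  then have u: "Re u \<ge> 1 / 2"
    using sq unfolding u_def w_def
    by (simp add: Re_divide power2_eq_square field_simps) 
  have dw: "deriv w z0 = - deriv q z0"
    unfolding w_def using holo z0b
    by (intro DERIV_imp_deriv) (auto intro!: derivative_eq_intros holomorphic_derivI)
  have "w z0 \<noteq> 0" using ge1 by auto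
  then have "u * (z0 * deriv w z0 / w z0) = z0 * deriv q z0 / q z0"
    using qnz by (simp add: u_def dw field_simps)
  moreover have "Re u \<le> Re (u * (z0 * deriv w z0 / w z0))"
    using w00 z0nz u by (intro jack_lemma[OF holw _ z0b _ less]) auto
  ultimately show False
    using u re[OF z0b] by simp
qed

text \<open>
  Elementary geometry of the disk: expanding \<open>\<bar>q - 1\<bar>\<^sup>2 \<le> r\<^sup>2\<close> gives
  \<open>\<bar>q\<bar>\<^sup>2 + (1 - r\<^sup>2) \<le> 2 Re q\<close>, and the inequality of arithmetic and geometric means on the
  left shows that the cosine \<open>c\<close> of the argument of \<open>q\<close> satisfies \<open>c\<^sup>2 \<ge> 1 - r\<^sup>2\<close>.
  As \<open>0 \<le> c \<le> 1\<close>, the square may be dropped.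
\<close>
lemma cos_Im_Ln_ge:
  assumes le: "cmod (q - 1) \<le> r" and r: "r < 1"
  shows "1 - r\<^sup>2 \<le> cos (Im (Ln q))" "\<bar>Im (Ln q)\<bar> < pi / 2"
proof -
  have "\<bar>Re (q - 1)\<bar> < 1"
    using abs_Re_le_cmod[of "q - 1"] le r by linarith
  then have re: "Re q > 0" by auto
  then have q: "q \<noteq> 0" by auto
  show "\<bar>Im (Ln q)\<bar> < pi / 2" using Re_Ln_pos_lt[OF q] re by simp
  have rpos: "0 \<le> r" using le norm_ge_zero order_trans by blast
  have r2: "r\<^sup>2 \<le> 1" using rpos r by (simp add: power_le_one)
  have "(cmod (q - 1))\<^sup>2 \<le> r\<^sup>2" using le by (simp add: power_mono)
  then have "(Re q)\<^sup>2 - 2 * Re q + 1 + (Im q)\<^sup>2 \<le> r\<^sup>2"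
    by (simp add: cmod_power2 power2_diff)
  then have "(cmod q)\<^sup>2 + (1 - r\<^sup>2) \<le> 2 * Re q" by (simp add: cmod_power2)
  then have "((cmod q)\<^sup>2 + (1 - r\<^sup>2))\<^sup>2 \<le> (2 * Re q)\<^sup>2"
    using r2 by (intro power_mono) auto
  moreover have "4 * ((cmod q)\<^sup>2 * (1 - r\<^sup>2)) \<le> ((cmod q)\<^sup>2 + (1 - r\<^sup>2))\<^sup>2"
    using zero_le_power2[of "(cmod q)\<^sup>2 - (1 - r\<^sup>2)"]
    by (simp add: power2_sum power2_diff)
  ultimately have "(cmod q)\<^sup>2 * (1 - r\<^sup>2) \<le> (Re q)\<^sup>2" by (simp add: power_mult_distrib)
  then have sq: "1 - r\<^sup>2 \<le> (Re q / cmod q)\<^sup>2"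
    using q by (simp add: power_divide field_simps)
  have c: "cos (Im (Ln q)) = Re q / cmod q"
    using q by (metis Arg_def cos_Arg)
  have "(Re q / cmod q)\<^sup>2 \<le> Re q / cmod q"
    using re complex_Re_le_cmod[of q] q
    unfolding power2_eq_square by (intro mult_left_le) auto
  then show "1 - r\<^sup>2 \<le> cos (Im (Ln q))" using sq c by linarith
qed

text \<open>The graph of a concave function lies above its chord from 0 to \<open>\<theta>\<close>.\<close>
lemma cos_scale_ge:
  fixes a \<theta> :: real
  assumes "0 \<le> a" "a \<le> 1" "\<bar>\<theta>\<bar> \<le> pi / 2"
  shows "1 - a * (1 - cos \<theta>) \<le> cos (a * \<theta>)"
proof -
  have "concave_on {- (pi / 2)..pi / 2} cos"
    by (rule f''_le0_imp_concave[where f' = "\<lambda>x. - sin x" and f'' = "\<lambda>x. - cos x"])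
      (auto intro!: derivative_eq_intros cos_ge_zero)
  moreover have "\<theta> \<in> {- (pi / 2)..pi / 2}" using assms(3) by auto
  ultimately have "(1 - a) * cos 0 + a * cos \<theta> \<le> cos ((1 - a) *\<^sub>R 0 + a *\<^sub>R \<theta>)"
    using assms(1,2) by (intro concave_onD) auto
  then show ?thesis by (simp add: algebra_simps)
qed

text \<open>
  The argument bound for \<open>h'\<close>. The logarithm \<open>L\<close> of \<open>h'\<close> that vanishes at 0 exists because the
  disk is simply connected, and \<open>q = exp (- L / \<alpha>)\<close> realises the power
  \<open>h' powr (- 1 / \<alpha>)\<close>. Since \<open>q\<close> stays in the disk of radius 1 around 1, the principal
  logarithm applies to it, and \<open>L = - \<alpha> Ln q\<close> turns the bound on the argument of \<open>q\<close>
  into one for \<open>h'\<close>.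
\<close>
lemma Re_deriv_ge_of_class_F:
  assumes \<alpha>: "0 < \<alpha>" "\<alpha> \<le> 1" and h: "h \<in> class_F \<alpha>" and z: "z \<in> unit_disk"
  shows "cmod (deriv h z) * (1 - \<alpha> * (cmod z)\<^sup>2) \<le> Re (deriv h z)"
proof -
  have holh: "h holomorphic_on unit_disk" and h0: "deriv h 0 = 1"
    and nz: "\<And>z. z \<in> unit_disk \<Longrightarrow> deriv h z \<noteq> 0"
    and re: "\<And>z. z \<in> unit_disk \<Longrightarrow>
      Re (1 + z * deriv (deriv h) z / deriv h z) > 1 - \<alpha> / 2"
    using h by (auto simp: class_F_def class_A_def locally_univalent_on_def)
  have holh': "deriv h holomorphic_on unit_disk"
    using holh by (intro holomorphic_deriv) auto
  have "simply_connected unit_disk" by (simp add: convex_imp_simply_connected)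
  then obtain G where G: "G holomorphic_on unit_disk"
      "\<And>z. z \<in> unit_disk \<Longrightarrow> deriv h z = exp (G z)"
    using simply_connected_eq_holomorphic_log[of unit_disk] holh' nz by auto
  define L where "L = (\<lambda>z. G z - G 0)"
  have holL: "L holomorphic_on unit_disk"
    unfolding L_def using G(1) by (intro holomorphic_intros)
  have expL: "deriv h z = exp (L z)" if "z \<in> unit_disk" for z
    using G(2)[OF that] G(2)[of 0] h0 by (simp add: L_def exp_diff)
  have DL: "(L has_field_derivative deriv (deriv h) z / deriv h z) (at z)"
    if "z \<in> unit_disk" for z
  proof -
    have d: "(L has_field_derivative deriv L z) (at z)"
      using holL that by (intro holomorphic_derivI) auto
    have "((\<lambda>z. exp (L z)) has_field_derivative exp (L z) * deriv L z) (at z)"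
      by (rule DERIV_chain2[OF DERIV_exp d])
    then have "(deriv h has_field_derivative exp (L z) * deriv L z) (at z)"
      by (rule has_field_derivative_transform_within_open[where S = unit_disk])
        (use that expL in auto)
    then have "deriv (deriv h) z = deriv h z * deriv L z"
      using expL that by (simp add: DERIV_imp_deriv)
    then show ?thesis using d nz that by simp
  qed
  define q where "q = (\<lambda>z. exp (- L z / of_real \<alpha>))"
  have holq: "q holomorphic_on unit_disk"
    unfolding q_def using holL \<alpha> by (intro holomorphic_intros) auto
  have Dq: "(q has_field_derivative
      q z * (- (deriv (deriv h) z / deriv h z) / of_real \<alpha>)) (at z)"
    if "z \<in> unit_disk" for z
    unfolding q_def using DL[OF that] \<alpha>
    by (auto intro!: derivative_eq_intros)
  have q0: "q 0 = 1" by (simp add: q_def L_def)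
  have "Re (z * deriv q z / q z) < 1 / 2" if "z \<in> unit_disk" for z
  proof -
    have "z * deriv q z / q z = - (z * deriv (deriv h) z / deriv h z) / of_real \<alpha>"
      using DERIV_imp_deriv[OF Dq[OF that]] by (simp add: q_def)
    then have "Re (z * deriv q z / q z) = - Re (z * deriv (deriv h) z / deriv h z) / \<alpha>"
      by (metis Re_divide_of_real uminus_complex.sel(1))
    also have "\<dots> < \<alpha> / 2 / \<alpha>"
    proof (rule divide_strict_right_mono)
      show "- Re (z * deriv (deriv h) z / deriv h z) < \<alpha> / 2"
        using re[OF that] by simp
    qed (rule \<alpha>(1))
    finally show ?thesis using \<alpha> by simp
  qed
  then have q1: "cmod (q z - 1) < 1" if "z \<in> unit_disk" for z
    using norm_diff_one_less_if_Re_log_deriv_less[OF holq q0] that by (simp add: q_def)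
  have qz: "cmod (q z - 1) \<le> cmod z"
    by (rule Schwarz_Lemma(1)[of "\<lambda>z. q z - 1"])
      (use holq q0 q1 z in \<open>auto intro!: holomorphic_intros\<close>)
  \<comment> \<open>By definition of \<open>q\<close> this holds up to multiples of \<open>2 \<pi> \<i> \<alpha>\<close>; the difference is constant
    because its derivative vanishes, and it is 0 at the origin.\<close>
  have Lnq: "L z = - of_real \<alpha> * Ln (q z)" if z: "z \<in> unit_disk" for z
  proof -
    have "((\<lambda>z. of_real \<alpha> * Ln (q z) + L z) has_field_derivative 0) (at z within unit_disk)"
      if "z \<in> unit_disk" for z
    proof -
      have "\<bar>Re (q z - 1)\<bar> < 1"
        using abs_Re_le_cmod[of "q z - 1"] q1[OF that] by linarith
      then have "q z \<notin> \<real>\<^sub>\<le>\<^sub>0" by (auto simp: complex_nonpos_Reals_iff)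
      then have "((\<lambda>z. of_real \<alpha> * Ln (q z) + L z) has_field_derivative 0) (at z)"
        using Dq[OF that] DL[OF that] \<alpha>
        by (auto intro!: derivative_eq_intros simp: q_def field_simps)
      then show ?thesis by (rule has_field_derivative_at_within)
    qed
    then have "\<exists>c. \<forall>z\<in>unit_disk. of_real \<alpha> * Ln (q z) + L z = c"
      by (intro has_field_derivative_zero_constant convex_ball)
    then obtain c where c: "\<And>z. z \<in> unit_disk \<Longrightarrow> of_real \<alpha> * Ln (q z) + L z = c"
      by blast
    from c[of 0] have "c = 0" using q0 by (simp add: L_def)
    then show ?thesis using c[OF z] by (simp add: add_eq_0_iff2)
  qed
  have "1 - \<alpha> * (cmod z)\<^sup>2 \<le> 1 - \<alpha> * (1 - cos (Im (Ln (q z))))"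
    using cos_Im_Ln_ge(1)[OF qz] z \<alpha> by simp
  also have "\<dots> \<le> cos (\<alpha> * Im (Ln (q z)))"
    using cos_Im_Ln_ge(2)[OF qz] z \<alpha> by (intro cos_scale_ge) auto
  also have "\<dots> = cos (Im (L z))" by (simp add: Lnq[OF z])
  finally show ?thesis
    by (simp add: expL[OF z] Re_exp)
qed

text \<open>
  If \<open>f = h + cnj g\<close>, then the derivative of \<open>f\<close> along a segment with direction \<open>d\<close> is
  \<open>h' d + cnj (g' d)\<close>, and its component along \<open>d\<close>, the real part of its product with
  \<open>cnj d\<close>, is at least \<open>\<bar>d\<bar>\<^sup>2 (Re h' - \<bar>g'\<bar>)\<close>.
\<close>
lemma inj_on_harmonic_if_Re_deriv_dominates:
  assumes conv: "convex S" and op: "open S"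
    and holh: "h holomorphic_on S" and holg: "g holomorphic_on S"
    and less: "\<And>z. z \<in> S \<Longrightarrow> cmod (deriv g z) < Re (deriv h z)"
  shows "inj_on (\<lambda>z. h z + cnj (g z)) S"
proof (rule inj_onI, rule ccontr)
  fix a b assume a: "a \<in> S" and b: "b \<in> S" and eq: "h a + cnj (g a) = h b + cnj (g b)"
    and "a \<noteq> b"
  define d where "d = b - a"
  have d: "d \<noteq> 0" using \<open>a \<noteq> b\<close> by (simp add: d_def)
  \<comment> \<open>\<open>F\<close> has the same real part as \<open>cnj d * f\<close> on the segment; conjugating the term with \<open>g\<close>
    makes it holomorphic, so that complex derivatives can be used.\<close>
  define F where "F = (\<lambda>s. cnj d * h (a + s * d) + d * g (a + s * d))"
  define F' where "F' = (\<lambda>s. cnj d * (deriv h (a + s * d) * d) + d * (deriv g (a + s * d) * d))"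
  have seg: "a + of_real t * d \<in> S" if "0 \<le> t" "t \<le> 1" for t :: real
    using convexD_alt[OF conv a b that] by (simp add: d_def scaleR_conv_of_real algebra_simps)
  have DF: "(F has_field_derivative F' (of_real t)) (at (of_real t))"
    if "0 \<le> t" "t \<le> 1" for t :: real
  proof -
    have l: "((\<lambda>s. a + s * d) has_field_derivative d) (at (of_real t))"
      by (auto intro!: derivative_eq_intros)
    note hd = DERIV_chain2[OF holomorphic_derivI[OF holh op seg[OF that]] l]
    note gd = DERIV_chain2[OF holomorphic_derivI[OF holg op seg[OF that]] l]
    show ?thesis unfolding F_def F'_def by (intro DERIV_add DERIV_cmult hd gd)
  qed
  have pos: "Re (F' (of_real t)) > 0" if "0 \<le> t" "t \<le> 1" for t :: real
  proof -
    let ?z = "a + of_real t * d"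
    have "Re (cnj d * (deriv h ?z * d)) = (cmod d)\<^sup>2 * Re (deriv h ?z)"
      unfolding cmod_power2 by (simp add: algebra_simps power2_eq_square)
    moreover have "\<bar>Re (d * (deriv g ?z * d))\<bar> \<le> (cmod d)\<^sup>2 * cmod (deriv g ?z)"
      using abs_Re_le_cmod[of "d * (deriv g ?z * d)"]
      by (simp add: norm_mult power2_eq_square mult_ac)
    moreover have "(cmod d)\<^sup>2 * cmod (deriv g ?z) < (cmod d)\<^sup>2 * Re (deriv h ?z)"
      using less[OF seg[OF that]] d by simp
    ultimately show ?thesis unfolding F'_def plus_complex.sel by linarith
  qed
  have "Re (F (of_real 0)) < Re (F (of_real 1))"
  proof (rule DERIV_pos_imp_increasing[where f = "\<lambda>t::real. Re (F (of_real t))"])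
    fix t :: real assume "0 \<le> t" "t \<le> 1"
    then show "\<exists>y. ((\<lambda>t. Re (F (of_real t))) has_real_derivative y) (at t) \<and> 0 < y"
      using has_field_derivative_Re[OF has_vector_derivative_real_field[OF DF]] pos by blast
  qed simp
  moreover have "Re (F 1) - Re (F 0) =
      Re (cnj d * ((h b + cnj (g b)) - (h a + cnj (g a))))"
    by (simp add: F_def d_def algebra_simps)
  ultimately show False using eq by simp
qed

theorem theorem5p2:
  fixes \<alpha> :: real and f h g :: "complex \<Rightarrow> complex"
  assumes "0 < \<alpha>" and "\<alpha> < 1 / 2"
    and "h \<in> class_F \<alpha>"
    and "sense_preserving_harmonic f h g"
    and "\<And>z. z \<in> unit_disk \<Longrightarrow>
      cmod (dilatation h g z) \<le> 1 - \<alpha> * cmod z * (1 + cmod z)"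
  shows "inj_on f unit_disk"
proof -
  have holh: "h holomorphic_on unit_disk" and holg: "g holomorphic_on unit_disk"
    and f: "\<And>z. z \<in> unit_disk \<Longrightarrow> f z = h z + cnj (g z)"
    and jac: "\<And>z. z \<in> unit_disk \<Longrightarrow> (cmod (deriv g z))\<^sup>2 < (cmod (deriv h z))\<^sup>2"
    using assms(4) by (auto simp: sense_preserving_harmonic_def harmonic_mapping_rep_def
        harmonic_jacobian_def)
  have "cmod (deriv g z) < Re (deriv h z)" if z: "z \<in> unit_disk" for z
  proof (cases "z = 0")
    case True
    have "deriv h 0 = 1" using assms(3) by (simp add: class_F_def class_A_def)
    then show ?thesis
      using jac[OF z] True by (simp add: power_less_one_iff abs_square_less_1)
  next
    case False
    have h': "cmod (deriv h z) > 0"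
      using assms(3) z by (auto simp: class_F_def locally_univalent_on_def)
    have "cmod (deriv g z) = cmod (deriv h z) * cmod (dilatation h g z)"
      using h' by (simp add: dilatation_def norm_divide)
    also have "\<dots> \<le> cmod (deriv h z) * (1 - \<alpha> * cmod z * (1 + cmod z))"
      using assms(5)[OF z] by (intro mult_left_mono) auto
    also have "\<dots> < cmod (deriv h z) * (1 - \<alpha> * (cmod z)\<^sup>2)"
      using h' False assms(1) by (simp add: power2_eq_square algebra_simps)
    also have "\<dots> \<le> Re (deriv h z)"
      using Re_deriv_ge_of_class_F[OF _ _ assms(3) z] assms(1,2) by simp
    finally show ?thesis .
  qed
  then have "inj_on (\<lambda>z. h z + cnj (g z)) unit_disk"
    using holh holg by (intro inj_on_harmonic_if_Re_deriv_dominates) auto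
  then show ?thesis using f by (simp add: inj_on_def)
qed

end
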